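(* For every integer $k\ge 3$, there is no series-parallel broadcast graph on $2^k$ vertices.
   Context: A multigraph is series-parallel (SP) if it can be obtained from $K_2$ by a finite sequence of series extensions (replace an edge $\{x,y\}$ by a new vertex $z$ and edges $\{x,z\},\{z,y\}$) and parallel extensions (add an edge parallel to an existing edge); a simple graph is SP if it is the result of such a sequence with no multiple edges at the end. Broadcasting: initially only an originator holds a message; in each discrete time unit, every informed vertex may inform at most one uninformed neighbor. $b(v,G)$ is the minimum number of time units to inform all vertices from originator $v$, and $b(G)=\max_v b(v,G)$. A connected graph $G$ on $n$ vertices is a broadcast graph if $b(G)=\lceil \log_2 n\rceil$. *)

theory Defs
  imports Complex_Main "HOL-Library.Multiset"
begin

text \<open>A multigraph is given by a vertex set together with a multiset of edges, an edge being the
  set of its two end points; a simple graph has a set of edges instead.\<close>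

inductive sp_multigraph :: "'a set \<Rightarrow> 'a set multiset \<Rightarrow> bool" where
  K2: "x \<noteq> y \<Longrightarrow> sp_multigraph {x, y} {#{x, y}#}"
| series: "sp_multigraph V M \<Longrightarrow> {x, y} \<in># M \<Longrightarrow> z \<notin> V \<Longrightarrow>
    sp_multigraph (insert z V) (M - {#{x, y}#} + {#{x, z}, {z, y}#})"
| parallel: "sp_multigraph V M \<Longrightarrow> e \<in># M \<Longrightarrow> sp_multigraph V (add_mset e M)"

definition simple_graph :: "'a set \<Rightarrow> 'a set set \<Rightarrow> bool" where
  "simple_graph V E \<longleftrightarrow> finite V \<and> V \<noteq> {} \<and> (\<forall>e\<in>E. e \<subseteq> V \<and> card e = 2)"

definition series_parallel :: "'a set \<Rightarrow> 'a set set \<Rightarrow> bool" where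
  "series_parallel V E \<longleftrightarrow> simple_graph V E \<and> sp_multigraph V (mset_set E)"

definition connected_graph :: "'a set \<Rightarrow> 'a set set \<Rightarrow> bool" where
  "connected_graph V E \<longleftrightarrow> (\<forall>u\<in>V. \<forall>w\<in>V. (u, w) \<in> {(x, y). {x, y} \<in> E}\<^sup>*)"

text \<open>In one time unit with informed set \<open>I\<close>, \<open>c u = Some w\<close> means that \<open>u\<close> informs \<open>w\<close>, and
  \<open>c u = None\<close> that \<open>u\<close> is idle.\<close>

definition call_round :: "'a set \<Rightarrow> 'a set set \<Rightarrow> 'a set \<Rightarrow> ('a \<rightharpoonup> 'a) \<Rightarrow> bool" where
  "call_round V E I c \<longleftrightarrow>
    dom c \<subseteq> I \<and> (\<forall>u w. c u = Some w \<longrightarrow> w \<in> V - I \<and> {u, w} \<in> E)"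

text \<open>\<open>can_inform V E v t I\<close>: starting from originator \<open>v\<close>, it is possible that \<open>I\<close> is exactly the
  set of informed vertices after \<open>t\<close> time units.\<close>

inductive can_inform :: "'a set \<Rightarrow> 'a set set \<Rightarrow> 'a \<Rightarrow> nat \<Rightarrow> 'a set \<Rightarrow> bool"
  for V E v where
  start: "can_inform V E v 0 {v}"
| round: "can_inform V E v t I \<Longrightarrow> call_round V E I c \<Longrightarrow>
    can_inform V E v (Suc t) (I \<union> ran c)"

text \<open>The following two values are meaningful for connected finite graphs only, where some
  \<open>t\<close> as below exists for every originator.\<close>

definition broadcast_time_from :: "'a \<Rightarrow> 'a set \<Rightarrow> 'a set set \<Rightarrow> nat" where
  "broadcast_time_from v V E = (LEAST t. can_inform V E v t V)"

definition broadcast_time :: "'a set \<Rightarrow> 'a set set \<Rightarrow> nat" where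
  "broadcast_time V E = Max ((\<lambda>v. broadcast_time_from v V E) ` V)"

definition broadcast_graph :: "'a set \<Rightarrow> 'a set set \<Rightarrow> bool" where
  "broadcast_graph V E \<longleftrightarrow> simple_graph V E \<and> connected_graph V E \<and>
    int (broadcast_time V E) = \<lceil>log 2 (real (card V))\<rceil>"

lemma sp_multigraph_wf:
  "sp_multigraph V M \<Longrightarrow> finite V \<and> (\<forall>e\<in>#M. e \<subseteq> V \<and> card e = 2)"
proof (induction rule: sp_multigraph.induct)
  case (K2 x y)
  then show ?case by simp
next
  case (series V M x y z)
  then have "x \<in> V" "y \<in> V" by auto
  with series show ?case
    by (auto dest: in_diffD simp: card_insert_if)
next
  case (parallel V M e)
  then show ?case by auto
qed

end

theory Submission imports Defs begin

text \<open>The vertex created by the last series extension keeps at most two neighbours, since parallel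
  extensions do not change adjacency. On the other hand, informing \<open>2 ^ k\<close> vertices in \<open>k\<close> time
  units forces every informed vertex, in particular the originator, to make a call in each of the
  \<open>k\<close> units. So every vertex of a broadcast graph on \<open>2 ^ k\<close> vertices has at least \<open>k\<close>
  neighbours.\<close>

lemma sp_multigraph_two_neighbours:
  assumes "sp_multigraph V M"
  shows "\<exists>v\<in>V. \<exists>x y. {w. {v, w} \<in># M} \<subseteq> {x, y}"
  using assms
proof (induction rule: sp_multigraph.induct)
  case (K2 x y)
  then show ?case by (auto simp: doubleton_eq_iff)
next
  case (series V M x y z)
  have "w \<in> {x, y}" if "{z, w} \<in># M - {#{x, y}#} + {#{x, z}, {z, y}#}" for w
  proof -
    \<comment> \<open>Edges of \<open>M\<close> lie inside \<open>V\<close>, and \<open>z\<close> is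
      fresh, so only the two new edges can contain \<open>z\<close>.\<close>
    have "{z, w} \<notin># M - {#{x, y}#}"
      using sp_multigraph_wf[OF series.hyps(1)] series.hyps(3) in_diffD by fastforce
    with that show ?thesis by (auto simp: doubleton_eq_iff)
  qed
  then show ?case by blast
next
  case (parallel V M e)
  \<comment> \<open>Neighbours are counted without multiplicity, so a further copy of
    \<open>e\<close> changes nothing.\<close>
  then have "set_mset (add_mset e M) = set_mset M" by auto
  with parallel.IH show ?case by simp
qed

lemma can_inform_subset:
  assumes "can_inform V E v t I" "v \<in> V"
  shows "v \<in> I \<and> I \<subseteq> V"
  using assms by induction (auto simp: call_round_def ran_def)

lemma call_round_card_ran:
  assumes "call_round V E I c" "finite I"
  shows "card (ran c) \<le> card (dom c)" "card (dom c) \<le> card I"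
proof -
  have "finite (dom c)" using assms by (auto simp: call_round_def intro: finite_subset)
  moreover have "ran c = (the \<circ> c) ` dom c" by (force simp: ran_def dom_def image_iff)
  ultimately show "card (ran c) \<le> card (dom c)" by (simp add: card_image_le)
  show "card (dom c) \<le> card I" using assms by (auto simp: call_round_def intro: card_mono)
qed

text \<open>The informed set at most doubles in each unit. Both claims share one induction because
  equality after \<open>Suc t\<close> units forces equality after \<open>t\<close>, so the neighbour
  count can be carried along.\<close>

lemma can_inform_card:
  assumes "can_inform V E v t I" "v \<in> V" "finite V"
  shows "card I \<le> 2 ^ t \<and> (card I = 2 ^ t \<longrightarrow> t \<le> card {w \<in> I. {v, w} \<in> E})"
  using assms
proof induction
  case start
  then show ?case by simp
next
  case (round t I c)
  have I: "v \<in> I" "I \<subseteq> V" using can_inform_subset[OF round.hyps(1)] round.prems by auto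
  then have fin: "finite I" using round.prems finite_subset by blast
  note ran = call_round_card_ran[OF round.hyps(2) fin]
  have Un: "card (I \<union> ran c) \<le> card I + card (ran c)" by (rule card_Un_le)
  have IH: "card I \<le> 2 ^ t" "card I = 2 ^ t \<longrightarrow> t \<le> card {w \<in> I. {v, w} \<in> E}"
    using round by auto
  have "Suc t \<le> card {w \<in> I \<union> ran c. {v, w} \<in> E}" if "card (I \<union> ran c) = 2 ^ Suc t"
  proof -
    \<comment> \<open>Equality holds throughout \<open>card (I \<union> ran c) \<le> card I + card
      (ran c) \<le> card I + card (dom c) \<le> 2 * card I \<le> 2 ^ Suc t\<close>.\<close>
    have eq: "card I = 2 ^ t" "card (dom c) = card I"
      using that IH(1) Un ran by auto
    have "dom c = I"
      using eq(2) fin round.hyps(2) by (simp add: call_round_def card_subset_eq)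
    \<comment> \<open>No informed vertex is idle, so \<open>v\<close> calls too; its target lies
      outside \<open>I\<close> and is a neighbour not yet counted.\<close>
    then obtain w where w: "c v = Some w" using I by blast
    then have "w \<notin> I" "{v, w} \<in> E" "w \<in> ran c"
      using round.hyps(2) by (auto simp: call_round_def intro: ranI)
    moreover have "I \<union> ran c \<subseteq> V"
      using round.hyps(2) I by (auto simp: call_round_def ran_def)
    then have "finite (I \<union> ran c)" using round.prems finite_subset by blast
    ultimately have "card (insert w {w \<in> I. {v, w} \<in> E}) \<le> card {w \<in> I \<union> ran c. {v, w} \<in> E}"
      by (intro card_mono) auto
    then show ?thesis using IH eq fin \<open>w \<notin> I\<close> by simp
  qed
  then show ?case using IH(1) Un ran by auto
qed

lemma connected_graph_crossing_edge:
  assumes "connected_graph V E" "v \<in> I" "I \<subseteq> V" "I \<noteq> V" "\<forall>e\<in>E. e \<subseteq> V"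
  shows "\<exists>x\<in>I. \<exists>y\<in>V - I. {x, y} \<in> E"
proof (rule ccontr)
  assume none: "\<not> ?thesis"
  obtain w where w: "w \<in> V" "w \<notin> I" using assms by blast
  then have "(v, w) \<in> {(x, y). {x, y} \<in> E}\<^sup>*"
    using assms by (auto simp: connected_graph_def)
  \<comment> \<open>Without a crossing edge, a walk starting at \<open>v\<close> never leaves
    \<open>I\<close>.\<close>
  then have "w \<in> I"
  proof induction
    case (step y z)
    then have "{y, z} \<in> E" by simp
    moreover from this have "z \<in> V" using assms(5) by blast
    ultimately show ?case using none step.IH by blast
  qed fact
  with w show False by simp
qed

text \<open>Ensures that the \<open>LEAST\<close> in \<open>broadcast_time_from\<close> is attained.
  A slow schedule suffices: one call per time unit, along an edge leaving the informed set.\<close>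

lemma connected_graph_can_inform:
  assumes "connected_graph V E" "finite V" "\<forall>e\<in>E. e \<subseteq> V" "v \<in> V"
  shows "\<exists>t. can_inform V E v t V"
proof -
  have "n \<le> card V - 1 \<Longrightarrow> \<exists>t I. can_inform V E v t I \<and> card I = Suc n" for n
  proof (induction n)
    case 0
    have "can_inform V E v 0 {v}" by (rule can_inform.start)
    then show ?case by (intro exI[of _ 0] exI[of _ "{v}"]) simp
  next
    case (Suc n)
    then obtain t I where tI: "can_inform V E v t I" "card I = Suc n" by auto
    have I: "v \<in> I" "I \<subseteq> V" using can_inform_subset[OF tI(1) assms(4)] by auto
    moreover have "I \<noteq> V" using tI(2) Suc.prems by auto
    ultimately obtain x y where xy: "x \<in> I" "y \<in> V - I" "{x, y} \<in> E"
      using connected_graph_crossing_edge[OF assms(1) _ _ _ assms(3)] by meson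
    have "call_round V E I [x \<mapsto> y]" using xy by (auto simp: call_round_def)
    from can_inform.round[OF tI(1) this] have "can_inform V E v (Suc t) (insert y I)"
      by simp
    moreover have "card (insert y I) = Suc (Suc n)"
      using xy tI(2) finite_subset[OF I(2) assms(2)] by simp
    ultimately show ?case by blast
  qed
  then obtain t I where tI: "can_inform V E v t I" "card I = Suc (card V - 1)" by blast
  \<comment> \<open>Makes the truncated subtraction exact:
    \<open>Suc (card V - 1) = card V\<close>.\<close>
  moreover have "card V > 0" using assms(2,4) by (auto simp: card_gt_0_iff)
  ultimately have "I = V"
    using can_inform_subset[OF tI(1) assms(4)] assms(2) by (simp add: card_subset_eq)
  with tI show ?thesis by blast
qed

lemma broadcast_graph_degree:
  assumes "broadcast_graph V E" "card V = 2 ^ k" "v \<in> V"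
  shows "k \<le> card {w \<in> V. {v, w} \<in> E}"
proof -
  have V: "finite V" "connected_graph V E" "\<forall>e\<in>E. e \<subseteq> V"
    using assms(1) by (auto simp: broadcast_graph_def simple_graph_def)
  have "broadcast_time V E = k"
    using assms(1,2) by (simp add: broadcast_graph_def log_nat_power)
  moreover have "broadcast_time_from v V E \<le> broadcast_time V E"
    unfolding broadcast_time_def using V assms(3) by simp
  moreover have inform: "can_inform V E v (broadcast_time_from v V E) V"
    unfolding broadcast_time_from_def
    using connected_graph_can_inform[OF V(2,1,3) assms(3)] by (rule LeastI_ex)
  \<comment> \<open>The doubling bound gives \<open>2 ^ k \<le> 2 ^ t\<close> for the broadcast time
    \<open>t\<close> from \<open>v\<close>, while \<open>t \<le> k\<close>; so \<open>t = k\<close>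
    and the equality case applies.\<close>
  moreover note can_inform_card[OF inform assms(3) V(1)]
  ultimately show ?thesis using assms(2) by auto
qed

theorem theorem3:
  fixes k :: nat
  assumes "k \<ge> 3"
  shows "\<not> (\<exists>(V :: 'a set) (E :: 'a set set).
           series_parallel V E \<and> broadcast_graph V E \<and> card V = 2 ^ k)"
proof clarify
  fix V :: "'a set" and E :: "'a set set"
  assume sp: "series_parallel V E" and bg: "broadcast_graph V E" and card: "card V = 2 ^ k"
  have "E \<subseteq> Pow V" "finite V" using sp by (auto simp: series_parallel_def simple_graph_def)
  \<comment> \<open>\<open>mset_set\<close> of an infinite set is empty; finiteness makes its
    elements exactly the edges in \<open>E\<close>.\<close>
  then have "finite E" by (meson finite_Pow_iff finite_subset)
  then obtain v x y where v: "v \<in> V" "{w. {v, w} \<in> E} \<subseteq> {x, y}"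
    using sp sp_multigraph_two_neighbours[of V "mset_set E"] by (auto simp: series_parallel_def)
  have "k \<le> card {w \<in> V. {v, w} \<in> E}" by (rule broadcast_graph_degree[OF bg card v(1)])
  also have "\<dots> \<le> card {x, y}" using v(2) by (intro card_mono) auto
  also have "\<dots> \<le> 2" by (simp add: card_insert_if)
  finally show False using assms by simp
qed

end
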